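(* The following sets are in bijection with one another: (i) the set $L_3$; (ii) the set of CII granules; (iii) the set of AINs; (iv) the set $\mathbb{A}_3$.
   Context: $L_3=\{(x_1,x_2,x_3)\in[0,1]^3: x_1\le x_2\le x_3\}$. $\mathbb{I}$ is the set of all closed intervals $[a,b]\subseteq[0,1]$ (with $a\le b$). A cognitive interval information (CII) granule is a pair $(x,[a^-,a^+])\in[0,1]\times\mathbb{I}$ such that $x\in[a^-,a^+]$. An asymmetric interval number (AIN) is a pair, written $[a^-,a^+]_x$, consisting of an interval $[a^-,a^+]\subseteq[0,1]$ and an expected value $x\in[a^-,a^+]$. $\mathbb{A}_3=\{(a_1,a_2,a_3)\in[0,1]^3: a_1+a_2+a_3\le 1\}$. *)

theory Defs
  imports Complex_Main "HOL-Library.Equipollence"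
begin

definition L3 :: "(real \<times> real \<times> real) set" where
  "L3 = {(x1, x2, x3) \<in> {0..1} \<times> {0..1} \<times> {0..1}. x1 \<le> x2 \<and> x2 \<le> x3}"

text \<open>Intervals are represented as sets of reals; the condition \<open>a \<le> b\<close> makes them nonempty.\<close>

definition unit_intervals :: "real set set" where
  "unit_intervals = {{a..b} | a b. a \<le> b \<and> {a..b} \<subseteq> {0..1}}"

definition CII_granules :: "(real \<times> real set) set" where
  "CII_granules = {(x, I) \<in> {0..1} \<times> unit_intervals. x \<in> I}"

definition AINs :: "(real set \<times> real) set" where
  "AINs = {(I, x). I \<in> unit_intervals \<and> x \<in> I}"

definition A3 :: "(real \<times> real \<times> real) set" where
  "A3 = {(a1, a2, a3) \<in> {0..1} \<times> {0..1} \<times> {0..1}. a1 + a2 + a3 \<le> 1}"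

end

theory Submission
  imports Defs
begin

text \<open>A nonempty closed interval is the same thing as its pair of endpoints, so an interval
  \<open>{a..b}\<close> in the unit interval together with a point \<open>x\<close> in it is the same thing as a chain
  \<open>a \<le> x \<le> b\<close> in the unit interval, that is, a point \<open>(a, x, b)\<close> of \<open>L3\<close>. CII granules and AINs
  both encode such a pointed interval and differ only in the order of the two components.
  Finally, an increasing triple is determined by its increments: taking successive differences
  (starting from 0) sends \<open>L3\<close> to triples of nonnegative numbers whose total is the last entry
  of the chain, hence at most 1, and partial sums invert this. All four sets are thus linked
  to \<open>L3\<close>, and the remaining pairs follow because equipollence is an equivalence relation.\<close>

text \<open>The endpoints of a nonempty interval are recovered as its infimum and supremum, which
  supplies the inverse; a degenerate interval causes no trouble, since then \<open>a = x = b\<close>.\<close>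

lemma L3_eqpoll_CII_granules: "L3 \<approx> CII_granules"
proof -
  have "bij_betw (\<lambda>(a, x, b). (x, {a..b})) L3 CII_granules"
    by (rule bij_betw_byWitness[where f' = "\<lambda>(x, I). (Inf I, x, Sup I)"])
       (auto simp: L3_def CII_granules_def unit_intervals_def)
  then show ?thesis
    by (auto simp: eqpoll_def)
qed

lemma CII_granules_eqpoll_AINs: "CII_granules \<approx> AINs"
proof -
  have "bij_betw prod.swap CII_granules AINs"
    by (rule bij_betw_byWitness[where f' = prod.swap])
       (auto simp: CII_granules_def AINs_def unit_intervals_def)
  then show ?thesis
    by (auto simp: eqpoll_def)
qed

text \<open>Monotonicity of the chain becomes nonnegativity of the increments, and the upper bound 1 on
  its last entry becomes the bound on their sum.\<close>

lemma L3_eqpoll_A3: "L3 \<approx> A3"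
proof -
  have "bij_betw (\<lambda>(x1, x2, x3). (x1, x2 - x1, x3 - x2)) L3 A3"
    by (rule bij_betw_byWitness[where f' = "\<lambda>(a1, a2, a3). (a1, a1 + a2, a1 + a2 + a3)"])
       (auto simp: L3_def A3_def)
  then show ?thesis
    by (auto simp: eqpoll_def)
qed

theorem proposition3:
  "L3 \<approx> CII_granules \<and> L3 \<approx> AINs \<and> L3 \<approx> A3 \<and>
   CII_granules \<approx> AINs \<and> CII_granules \<approx> A3 \<and> AINs \<approx> A3"
  using L3_eqpoll_CII_granules CII_granules_eqpoll_AINs L3_eqpoll_A3
  by (meson eqpoll_sym eqpoll_trans)

end
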